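(* Let $\mathbb{V}$ be a finite dimensional real inner product space, $O \neq H \in \mathbb{V}$, and let $\mathbb{K}\subseteq\mathbb{V}$ be a nonempty cone. Then the following assertions hold. (i) For $\mathbb{J}\subseteq\mathbb{V}$: $\mathbb{J} \in \widehat{\mathcal{F}}(\mathbb{K})$ if and only if $\mathbb{J} = \mathrm{co}\,\mathbb{K}'$ for some cone $\mathbb{K}' \subseteq \mathbb{K}$. (ii) For $\mathbb{J}\subseteq\mathbb{V}$: $\mathbb{J} \in \widehat{\mathcal{F}}(\mathbb{K})$ if and only if $\mathbb{J} = \mathrm{co}\big(\bigcup \mathcal{F}\big)$ for some subfamily $\mathcal{F} \subseteq \widehat{\mathcal{F}}(\mathbb{K})$. (iii) Let $\mathbb{J}$ be a convex cone contained in $\mathrm{co}\,\mathbb{K}$. Assume that $\mathbb{K}$ and $\mathbb{J}$ are closed and $H \in \mathrm{int}(\mathbb{K}^* )$. Then $\mathbb{J} \in \widehat{\mathcal{F}}(\mathbb{K})$ if and only if $\zeta_p(\mathbb{K} \cap \mathbb{J}) = \zeta_p(\mathbb{J})$ for every $Q \in \mathbb{V}$.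
   Context: A set $\mathbb{C}\subseteq\mathbb{V}$ is a cone (not necessarily convex nor closed) if $\lambda A\in\mathbb{C}$ for every $A\in\mathbb{C}$ and $\lambda\ge 0$. $\mathrm{co}$ denotes the convex hull. The dual of a cone $\mathbb{C}$ is $\mathbb{C}^*=\{Y\in\mathbb{V}:\langle X,Y\rangle\ge 0 \text{ for every } X\in\mathbb{C}\}$, and $\mathrm{int}(\mathbb{C}^* )$ is its interior. $\widehat{\mathcal{F}}(\mathbb{K})$ is the family of all convex cones $\mathbb{J}\subseteq\mathrm{co}\,\mathbb{K}$ satisfying $\mathrm{co}(\mathbb{K}\cap\mathbb{J})=\mathbb{J}$. For a family $\mathcal{F}$ of subsets of $\mathbb{V}$, $\bigcup\mathcal{F}=\bigcup_{U\in\mathcal{F}}U$. For a cone $\mathbb{C}\subseteq\mathbb{V}$ and $Q\in\mathbb{V}$, $\zeta_p(\mathbb{C})=\inf\{\langle Q,X\rangle : X\in\mathbb{C},\ \langle H,X\rangle=1\}$ (depending on $Q$ and $H$), with $\zeta_p(\mathbb{C})=\infty$ if the feasible set is empty. *)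

theory Defs
  imports "HOL-Analysis.Analysis"
begin

definition dual_cone :: "'a::real_inner set \<Rightarrow> 'a set"
  where "dual_cone C = {Y. \<forall>X\<in>C. inner X Y \<ge> 0}"

(* cone admits the empty set, as in the text; hence {} belongs to F_hat K
   (it is the hull of the empty subcone and of the empty subfamily).
   This is why the library's convex_cone, which demands nonemptiness, is not used. *)
definition F_hat :: "'a::real_vector set \<Rightarrow> 'a set set"
  where "F_hat K = {J. convex J \<and> cone J \<and> J \<subseteq> convex hull K \<and> convex hull (K \<inter> J) = J}"

(* The infimum is taken in the extended reals, so it is \<infinity> on an empty feasible set
   and -\<infinity> when the objective is unbounded below. *)
definition zeta_p :: "'a::real_inner \<Rightarrow> 'a \<Rightarrow> 'a set \<Rightarrow> ereal"
  where "zeta_p H Q C = (INF X\<in>{X \<in> C. inner H X = 1}. ereal (inner Q X))"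

end

theory Submission
  imports Defs
begin

text \<open>The first two equivalences are closure properties of the hull operator: the largest subcone of
  \<^term>\<open>K\<close> that can generate \<^term>\<open>J\<close> is \<^term>\<open>K \<inter> J\<close>, so \<^term>\<open>J\<close> belongs to the family as soon
  as any subcone generates it, and the generating subcones of the members of a subfamily together
  generate the hull of its union.

  For the third, a point of the interior of the dual cone is strictly positive on the cone away from
  the origin, even uniformly so (\<open>interior_dual_cone_norm_bound\<close>), and the dual does not change when
  passing to the convex hull. So every nonzero ray of \<^term>\<open>J\<close> meets the hyperplane
  \<^term>\<open>{X. inner H X = 1}\<close> in one point. One direction is linear duality: a lower bound \<open>m\<close> for
  \<^term>\<open>Q\<close> on the slice of a cone says that \<^term>\<open>Q - m *\<^sub>R H\<close> is nonnegative on the cone, and such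
  an inequality extends to the convex hull (\<open>zeta_p_convex_hull\<close>). For the other direction the uniform
  bound makes the slice of the closed cone \<^term>\<open>K \<inter> J\<close> compact, so its hull is closed; a point of
  the slice of \<^term>\<open>J\<close> outside that hull is strictly separated from it by some \<^term>\<open>Q\<close>, and for
  this \<^term>\<open>Q\<close> the two values differ (\<open>zeta_p_separates\<close>).\<close>

lemma mem_F_hatI:
  assumes "K' \<subseteq> K" "cone K'"
  shows "convex hull K' \<in> F_hat K"
proof -
  let ?J = "convex hull K'"
  have "K' \<subseteq> K \<inter> ?J"
    using assms(1) hull_subset[of K' convex] by blast
  then have "?J \<subseteq> convex hull (K \<inter> ?J)"
    by (rule hull_mono)
  moreover have "convex hull (K \<inter> ?J) \<subseteq> ?J"
    by (rule hull_minimal) auto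
  moreover have "cone ?J"
    using assms(2) by (rule cone_convex_hull)
  moreover have "?J \<subseteq> convex hull K"
    using assms(1) by (rule hull_mono)
  ultimately show ?thesis
    unfolding F_hat_def by auto
qed

lemma cone_Int: "cone A \<Longrightarrow> cone B \<Longrightarrow> cone (A \<inter> B)"
  by (simp add: cone_def)

lemma mem_F_hat_iff_hull_subcone:
  assumes "cone K"
  shows "J \<in> F_hat K \<longleftrightarrow> (\<exists>K'. K' \<subseteq> K \<and> cone K' \<and> J = convex hull K')"
proof
  assume "J \<in> F_hat K"
  then have "cone J" "J = convex hull (K \<inter> J)"
    by (auto simp: F_hat_def)
  then show "\<exists>K'. K' \<subseteq> K \<and> cone K' \<and> J = convex hull K'"
    using cone_Int[OF assms] by blast
qed (auto intro: mem_F_hatI)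

text \<open>A union of convex cones need not be convex, but its trace on \<^term>\<open>K\<close> is a subcone of
  \<^term>\<open>K\<close>, and this trace already generates every member of the subfamily.\<close>
lemma mem_F_hat_iff_hull_Union:
  assumes "cone K"
  shows "J \<in> F_hat K \<longleftrightarrow> (\<exists>\<F>. \<F> \<subseteq> F_hat K \<and> J = convex hull (\<Union>\<F>))"
proof
  assume J: "J \<in> F_hat K"
  then have "J = convex hull (\<Union>{J})"
    by (simp add: F_hat_def hull_same)
  then show "\<exists>\<F>. \<F> \<subseteq> F_hat K \<and> J = convex hull (\<Union>\<F>)"
    using J by blast
next
  assume "\<exists>\<F>. \<F> \<subseteq> F_hat K \<and> J = convex hull (\<Union>\<F>)"
  then obtain \<F> where F: "\<F> \<subseteq> F_hat K" and J: "J = convex hull (\<Union>\<F>)"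
    by blast
  let ?K' = "K \<inter> \<Union>\<F>"
  have "cone (\<Union>\<F>)"
    using F unfolding cone_def F_hat_def by blast
  with assms have "cone ?K'"
    by (rule cone_Int)
  have "U \<subseteq> convex hull ?K'" if "U \<in> \<F>" for U
  proof -
    have "U = convex hull (K \<inter> U)"
      using F that by (auto simp: F_hat_def)
    also have "\<dots> \<subseteq> convex hull ?K'"
      using that by (intro hull_mono) blast
    finally show ?thesis .
  qed
  then have "J \<subseteq> convex hull ?K'"
    unfolding J by (intro hull_minimal) auto
  moreover have "convex hull ?K' \<subseteq> J"
    unfolding J by (rule hull_mono) blast
  ultimately have "J = convex hull ?K'"
    by blast
  then show "J \<in> F_hat K"
    using \<open>cone ?K'\<close> mem_F_hatI[of ?K' K] by simp
qed

lemma dual_cone_antimono: "A \<subseteq> B \<Longrightarrow> dual_cone B \<subseteq> dual_cone A"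
  by (auto simp: dual_cone_def)

text \<open>Each dual vector cuts out a closed half-space, which is convex.\<close>
lemma dual_cone_convex_hull: "dual_cone (convex hull C) = dual_cone C"
proof
  show "dual_cone (convex hull C) \<subseteq> dual_cone C"
    by (rule dual_cone_antimono) (rule hull_subset)
  show "dual_cone C \<subseteq> dual_cone (convex hull C)"
  proof
    fix Y assume "Y \<in> dual_cone C"
    then have "convex hull C \<subseteq> {X. inner Y X \<ge> 0}"
      by (intro hull_minimal convex_halfspace_ge) (auto simp: dual_cone_def inner_commute)
    then show "Y \<in> dual_cone (convex hull C)"
      by (auto simp: dual_cone_def inner_commute)
  qed
qed

text \<open>Moving \<^term>\<open>H\<close> a fixed distance \<open>e\<close> straight against \<^term>\<open>X\<close> keeps it in the dual cone, and
  lowers its pairing with \<^term>\<open>X\<close> by \<open>e\<close> times the norm of \<^term>\<open>X\<close>.\<close>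
lemma interior_dual_cone_norm_bound:
  assumes "H \<in> interior (dual_cone C)"
  obtains e where "e > 0" "\<And>X. X \<in> C \<Longrightarrow> e * norm X \<le> inner H X"
proof -
  obtain e where e: "e > 0" "cball H e \<subseteq> dual_cone C"
    using assms by (auto simp: mem_interior_cball)
  have "e * norm X \<le> inner H X" if "X \<in> C" for X
  proof -
    have "H - e *\<^sub>R sgn X \<in> cball H e"
      using e(1) by (auto simp: dist_norm norm_sgn)
    then have "H - e *\<^sub>R sgn X \<in> dual_cone C"
      using e(2) by blast
    then have "0 \<le> inner X (H - e *\<^sub>R sgn X)"
      using that by (simp add: dual_cone_def)
    moreover have "inner X (sgn X) = norm X"
      by (cases "X = 0") (simp_all add: sgn_div_norm power2_norm_eq_inner[symmetric] power2_eq_square)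
    ultimately show ?thesis
      by (simp add: inner_diff_right inner_commute)
  qed
  with e(1) show ?thesis
    by (rule that)
qed

lemma interior_dual_cone_pos:
  assumes "H \<in> interior (dual_cone C)" "X \<in> C" "X \<noteq> 0"
  shows "inner H X > 0"
proof -
  obtain e where "e > 0" "e * norm X \<le> inner H X"
    using interior_dual_cone_norm_bound assms(1,2) by metis
  then show ?thesis
    using assms(3) by (smt (verit) mult_pos_pos zero_less_norm_iff)
qed

lemma zeta_p_lower:
  assumes "X \<in> C" "inner H X = 1"
  shows "zeta_p H Q C \<le> ereal (inner Q X)"
  unfolding zeta_p_def using assms by (intro INF_lower) simp

lemma zeta_p_antimono: "A \<subseteq> B \<Longrightarrow> zeta_p H Q B \<le> zeta_p H Q A"
  unfolding zeta_p_def by (rule INF_superset_mono) auto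

text \<open>Rescaling turns a bound \<open>m\<close> on the slice into the homogeneous inequality
  \<open>inner (Q - m *\<^sub>R H) Y \<ge> 0\<close> on the whole cone, which the convex hull inherits. Arguing with a real
  \<open>m\<close> strictly below \<^term>\<open>zeta_p H Q C\<close>, rather than with this value itself, covers the infinite
  values along with the finite ones.\<close>
lemma zeta_p_convex_hull:
  assumes C: "cone C" and pos: "\<And>X. X \<in> C \<Longrightarrow> X \<noteq> 0 \<Longrightarrow> inner H X > 0"
  shows "zeta_p H Q (convex hull C) = zeta_p H Q C"
proof (rule antisym)
  show "zeta_p H Q (convex hull C) \<le> zeta_p H Q C"
    by (rule zeta_p_antimono) (rule hull_subset)
  show "zeta_p H Q C \<le> zeta_p H Q (convex hull C)"
    unfolding zeta_p_def[of H Q "convex hull C"]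
  proof (rule INF_greatest, rule ccontr)
    fix X assume "X \<in> {X \<in> convex hull C. inner H X = 1}"
    then have X: "X \<in> convex hull C" "inner H X = 1"
      by auto
    assume "\<not> zeta_p H Q C \<le> ereal (inner Q X)"
    then obtain m where m: "inner Q X < m" "ereal m < zeta_p H Q C"
      using ereal_dense2[of "ereal (inner Q X)" "zeta_p H Q C"] by (auto simp: not_le)
    have "inner (Q - m *\<^sub>R H) Y \<ge> 0" if Y: "Y \<in> C" for Y
    proof (cases "Y = 0")
      case False
      let ?Z = "(1 / inner H Y) *\<^sub>R Y"
      have h: "inner H Y > 0"
        using pos Y False by blast
      then have "?Z \<in> C" "inner H ?Z = 1"
        using C Y by (auto simp: cone_def)
      then have "zeta_p H Q C \<le> ereal (inner Q ?Z)"
        by (rule zeta_p_lower)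
      with m(2) have "ereal m < ereal (inner Q ?Z)"
        by (rule less_le_trans)
      then have "m < inner Q Y / inner H Y"
        by simp
      then show ?thesis
        using h by (simp add: inner_diff_left pos_less_divide_eq)
    qed simp
    then have "Q - m *\<^sub>R H \<in> dual_cone (convex hull C)"
      unfolding dual_cone_convex_hull by (simp add: dual_cone_def inner_commute)
    then have "inner (Q - m *\<^sub>R H) X \<ge> 0"
      using X(1) by (simp add: dual_cone_def inner_commute)
    then show False
      using X(2) m(1) by (simp add: inner_diff_left)
  qed
qed

text \<open>The hull of a closed set need not be closed, so strict separation from it may fail. The
  interior condition on \<^term>\<open>H\<close> repairs this: it bounds the slice, whose hull is then compact.\<close>
lemma zeta_p_separates:
  fixes C :: "'a::euclidean_space set"
  assumes "closed C" and H: "H \<in> interior (dual_cone C)"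
    and X: "inner H X = 1" "X \<notin> convex hull C"
  obtains Q where "ereal (inner Q X) < zeta_p H Q C"
proof -
  let ?S = "{Y \<in> C. inner H Y = 1}"
  obtain e where e: "e > 0" "\<And>Y. Y \<in> C \<Longrightarrow> e * norm Y \<le> inner H Y"
    using interior_dual_cone_norm_bound[OF H] by blast
  have "norm Y \<le> 1 / e" if "Y \<in> ?S" for Y
    using e(2)[of Y] e(1) that by (simp add: pos_le_divide_eq mult.commute)
  then have "bounded ?S"
    unfolding bounded_iff by blast
  moreover have "closed ?S"
    using closed_Int[OF \<open>closed C\<close> closed_hyperplane[of H 1]] by (simp add: Collect_conj_eq)
  ultimately have "closed (convex hull ?S)"
    by (intro compact_imp_closed compact_convex_hull) (simp add: compact_eq_bounded_closed)
  moreover have "X \<notin> convex hull ?S"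
    using X(2) hull_mono[of ?S C convex] by blast
  ultimately obtain Q b where Qb: "inner Q X < b" "\<And>Y. Y \<in> convex hull ?S \<Longrightarrow> b < inner Q Y"
    using separating_hyperplane_closed_point[of "convex hull ?S" X] by auto
  have "ereal b \<le> zeta_p H Q C"
    unfolding zeta_p_def using Qb(2)
    by (intro INF_greatest) (auto intro: less_imp_le hull_inc)
  then have "ereal (inner Q X) < zeta_p H Q C"
    using Qb(1) by (simp add: less_le_trans[of _ "ereal b"])
  then show ?thesis
    by (rule that)
qed

lemma mem_F_hat_iff_zeta_p:
  fixes H :: "'a::euclidean_space"
  assumes "cone K" and J: "convex J" "cone J" "J \<subseteq> convex hull K"
    and "closed K" "closed J" and H: "H \<in> interior (dual_cone K)"
  shows "J \<in> F_hat K \<longleftrightarrow> (\<forall>Q. zeta_p H Q (K \<inter> J) = zeta_p H Q J)"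
proof
  have C: "cone (K \<inter> J)"
    using \<open>cone K\<close> J(2) by (rule cone_Int)
  assume "J \<in> F_hat K"
  then have "convex hull (K \<inter> J) = J"
    by (simp add: F_hat_def)
  moreover have "zeta_p H Q (convex hull (K \<inter> J)) = zeta_p H Q (K \<inter> J)" for Q
    using interior_dual_cone_pos[OF H] by (intro zeta_p_convex_hull[OF C]) auto
  ultimately show "\<forall>Q. zeta_p H Q (K \<inter> J) = zeta_p H Q J"
    by simp
next
  let ?C = "convex hull (K \<inter> J)"
  assume eq: "\<forall>Q. zeta_p H Q (K \<inter> J) = zeta_p H Q J"
  have cone_hull: "cone ?C"
    using \<open>cone K\<close> J(2) by (intro cone_convex_hull cone_Int)
  have HJ: "H \<in> interior (dual_cone J)"
    using H interior_mono[OF dual_cone_antimono[OF J(3)]] by (auto simp: dual_cone_convex_hull)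
  have HC: "H \<in> interior (dual_cone (K \<inter> J))"
    using H interior_mono[OF dual_cone_antimono[of "K \<inter> J" K]] by auto
  have "X \<in> ?C" if X: "X \<in> J" for X
  proof (cases "X = 0")
    case True
    have "K \<noteq> {}"
      using X J(3) by auto
    then have "0 \<in> K"
      using \<open>cone K\<close> cone_contains_0 by blast
    then show ?thesis
      using X True by (intro hull_inc) simp
  next
    case False
    let ?Z = "(1 / inner H X) *\<^sub>R X"
    have h: "inner H X > 0"
      using HJ X False by (rule interior_dual_cone_pos)
    then have Z: "?Z \<in> J" "inner H ?Z = 1"
      using J(2) X by (auto simp: cone_def)
    have "?Z \<in> ?C"
    proof (rule ccontr)
      assume "?Z \<notin> ?C"
      then obtain Q where "ereal (inner Q ?Z) < zeta_p H Q (K \<inter> J)"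
        using zeta_p_separates[OF closed_Int[OF \<open>closed K\<close> \<open>closed J\<close>] HC Z(2)] by blast
      also have "\<dots> = zeta_p H Q J"
        using eq by blast
      also have "\<dots> \<le> ereal (inner Q ?Z)"
        using Z by (rule zeta_p_lower)
      finally show False
        by simp
    qed
    then have "inner H X *\<^sub>R ?Z \<in> ?C"
      using cone_hull h by (meson cone_def less_imp_le)
    then show ?thesis
      using h by simp
  qed
  moreover have "?C \<subseteq> J"
    using J(1) by (intro hull_minimal) auto
  ultimately have "?C = J"
    by blast
  with J show "J \<in> F_hat K"
    by (simp add: F_hat_def)
qed

theorem theorem1p2:
  fixes H :: "'a::euclidean_space" and K :: "'a set"
  assumes "H \<noteq> 0" and "K \<noteq> {}" and "cone K"
  shows "(\<forall>J. J \<in> F_hat K \<longleftrightarrow> (\<exists>K'. K' \<subseteq> K \<and> cone K' \<and> J = convex hull K'))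
       \<and> (\<forall>J. J \<in> F_hat K \<longleftrightarrow> (\<exists>\<F>. \<F> \<subseteq> F_hat K \<and> J = convex hull (\<Union>\<F>)))
       \<and> (\<forall>J. convex J \<and> cone J \<and> J \<subseteq> convex hull K \<and> closed K \<and> closed J
               \<and> H \<in> interior (dual_cone K) \<longrightarrow>
             (J \<in> F_hat K \<longleftrightarrow> (\<forall>Q. zeta_p H Q (K \<inter> J) = zeta_p H Q J)))"
proof (intro conjI allI impI)
  fix J
  show "J \<in> F_hat K \<longleftrightarrow> (\<exists>K'. K' \<subseteq> K \<and> cone K' \<and> J = convex hull K')"
    using assms(3) by (rule mem_F_hat_iff_hull_subcone)
  show "J \<in> F_hat K \<longleftrightarrow> (\<exists>\<F>. \<F> \<subseteq> F_hat K \<and> J = convex hull (\<Union>\<F>))"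
    using assms(3) by (rule mem_F_hat_iff_hull_Union)
  assume "convex J \<and> cone J \<and> J \<subseteq> convex hull K \<and> closed K \<and> closed J
    \<and> H \<in> interior (dual_cone K)"
  then show "J \<in> F_hat K \<longleftrightarrow> (\<forall>Q. zeta_p H Q (K \<inter> J) = zeta_p H Q J)"
    using assms(3) by (intro mem_F_hat_iff_zeta_p) auto
qed

end
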